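(* Let $C$ be an $n$-dimensional Archimedean copula with generator $\phi$, and let $\chi$ be its weak lower tail dependence function. (i) If $\ln\phi^{-1}$ is regularly varying at $+\infty$ with index $\alpha>0$, then $\chi$ exists and, for all $\lambda_1,\dots,\lambda_n\ge0$ not all zero, $$\chi(\lambda_1,\dots,\lambda_n)=\frac{\max(\lambda_1,\dots,\lambda_n)}{\big(\lambda_1^{1/\alpha}+\dots+\lambda_n^{1/\alpha}\big)^\alpha}.$$ (ii) If $\ln\phi^{-1}$ is slowly varying at $+\infty$, then $\chi$ exists and, for all $\lambda_1,\dots,\lambda_n\ge0$ not all zero, $$\chi(\lambda_1,\dots,\lambda_n)=1.$$
   Context: Archimedean copula: given $\phi:[0,1]\to[0,\infty]$ continuous, strictly decreasing, with $\phi(0)=\infty$, $\phi(1)=0$, and such that the inverse $\phi^{-1}$ is completely monotonic, the Archimedean copula with generator $\phi$ is $$C(u_1,\dots,u_n)=\phi^{-1}\{\phi(u_1)+\dots+\phi(u_n)\}.$$ A function $f$ (here possibly negative) is regularly varying at $+\infty$ with index $\alpha$ if $f(ct)/f(t)\to c^\alpha$ as $t\to+\infty$ for every $c>0$, and slowly varying if this holds with $\alpha=0$. The weak lower tail dependence function of a copula $C$ is $$\chi(\lambda_1,\dots,\lambda_n)=\lim_{u\downarrow0}\frac{\min_i\ln u^{\lambda_i}}{\ln C(u^{\lambda_1},\dots,u^{\lambda_n})},$$ for $\lambda_1,\dots,\lambda_n\ge0$ not all zero, whenever the limit exists. *)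

theory Defs
  imports "HOL-Analysis.Analysis"
begin

text \<open>Complete monotonicity on \<open>(0, \<infinity>)\<close>. No condition is imposed at \<open>0\<close>: for the inverse of a
  generator, continuity at \<open>0\<close> already follows from continuity and strict monotonicity of the
  generator.\<close>

definition completely_monotonic :: "(real \<Rightarrow> real) \<Rightarrow> bool" where
  "completely_monotonic f \<longleftrightarrow>
     (\<forall>k. \<forall>t>0. (deriv ^^ k) f field_differentiable at t \<and> 0 \<le> (-1) ^ k * (deriv ^^ k) f t)"

text \<open>A generator maps \<open>[0, 1]\<close> to \<open>[0, \<infinity>]\<close>; its values outside \<open>[0, 1]\<close> are irrelevant.
  The inverse is a function on \<open>[0, \<infinity>]\<close>.\<close>

definition generator_inv :: "(real \<Rightarrow> ennreal) \<Rightarrow> ennreal \<Rightarrow> real" where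
  "generator_inv \<phi> = inv_into {0..1} \<phi>"

definition archimedean_generator :: "(real \<Rightarrow> ennreal) \<Rightarrow> bool" where
  "archimedean_generator \<phi> \<longleftrightarrow>
     continuous_on {0..1} \<phi> \<and> strict_antimono_on {0..1} \<phi> \<and> \<phi> 0 = \<infinity> \<and> \<phi> 1 = 0 \<and>
     completely_monotonic (\<lambda>t. generator_inv \<phi> (ennreal t))"

definition archimedean_copula :: "(real \<Rightarrow> ennreal) \<Rightarrow> real ^ 'n \<Rightarrow> real" where
  "archimedean_copula \<phi> u = generator_inv \<phi> (\<Sum>i\<in>UNIV. \<phi> (u $ i))"

definition regularly_varying :: "(real \<Rightarrow> real) \<Rightarrow> real \<Rightarrow> bool" where
  "regularly_varying f \<alpha> \<longleftrightarrow> (\<forall>c>0. ((\<lambda>t. f (c * t) / f t) \<longlongrightarrow> c powr \<alpha>) at_top)"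

definition slowly_varying :: "(real \<Rightarrow> real) \<Rightarrow> bool" where
  "slowly_varying f \<longleftrightarrow> regularly_varying f 0"

definition tail_ratio :: "(real ^ 'n \<Rightarrow> real) \<Rightarrow> real ^ 'n \<Rightarrow> real \<Rightarrow> real" where
  "tail_ratio C l u = (MIN i. ln (u powr (l $ i))) / ln (C (\<chi> i. u powr (l $ i)))"

definition weak_lower_tail_dep_exists :: "(real ^ 'n \<Rightarrow> real) \<Rightarrow> real ^ 'n \<Rightarrow> bool" where
  "weak_lower_tail_dep_exists C l \<longleftrightarrow> (\<exists>L. (tail_ratio C l \<longlongrightarrow> L) (at_right 0))"

text \<open>Meaningful only if \<open>weak_lower_tail_dep_exists C l\<close> holds.\<close>

definition weak_lower_tail_dep :: "(real ^ 'n \<Rightarrow> real) \<Rightarrow> real ^ 'n \<Rightarrow> real" where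
  "weak_lower_tail_dep C l = Lim (at_right 0) (tail_ratio C l)"

end

theory Submission imports Defs begin

text \<open>In the coordinates \<open>h = - ln \<phi>\<^sup>-\<^sup>1\<close>, \<open>g = h\<^sup>-\<^sup>1\<close> and \<open>x = - ln u\<close>, the tail ratio becomes
  \<open>(MAX i. l i) * x / h (\<Sum>i. g (l i * x))\<close>. If \<open>h\<close> is regularly varying with index \<open>\<alpha> > 0\<close>, then
  \<open>g (l * x) / g x\<close> tends to \<open>l powr (1 / \<alpha>)\<close>, so \<open>h (\<Sum>i. g (l i * x))\<close> behaves like
  \<open>x * (\<Sum>i. l i powr (1 / \<alpha>)) powr \<alpha>\<close>. If \<open>h\<close> is slowly varying, the sum lies between
  \<open>g (M * x)\<close> and \<open>n * g (M * x)\<close>, where \<open>M\<close> is the largest weight, and the factor \<open>n\<close> is lost under \<open>h\<close>.\<close>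

section \<open>Strictly increasing bijections of the half-line and their inverses\<close>

text \<open>\<open>right_inv\<close> makes \<open>h\<close> onto the half-line and strict
  monotonicity makes it one-to-one, so \<open>g\<close> is its inverse there. Both are total
  functions on the reals, hence the restriction to nonnegative arguments.\<close>

locale half_line_bijection =
  fixes h g :: "real \<Rightarrow> real"
  assumes strict_mono: "strict_mono_on {0..} h"
    and zero: "h 0 = 0"
    and inv_nonneg: "0 \<le> x \<Longrightarrow> 0 \<le> g x"
    and right_inv: "0 \<le> x \<Longrightarrow> h (g x) = x"
begin

lemma less_iff: "0 \<le> s \<Longrightarrow> 0 \<le> t \<Longrightarrow> h s < h t \<longleftrightarrow> s < t"
  using strict_mono_on_less[OF strict_mono] by auto

lemma le_iff: "0 \<le> s \<Longrightarrow> 0 \<le> t \<Longrightarrow> h s \<le> h t \<longleftrightarrow> s \<le> t"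
  using less_iff by (meson not_less)

lemma inv_less_iff: "0 \<le> x \<Longrightarrow> 0 \<le> y \<Longrightarrow> g x < g y \<longleftrightarrow> x < y"
  using less_iff[of "g x" "g y"] by (simp add: inv_nonneg right_inv)

lemma inv_le_iff: "0 \<le> x \<Longrightarrow> 0 \<le> y \<Longrightarrow> g x \<le> g y \<longleftrightarrow> x \<le> y"
  using inv_less_iff by (meson not_less)

lemma inv_zero: "g 0 = 0"
  using less_iff[of 0 "g 0"] inv_nonneg[of 0] by (simp add: right_inv zero)

lemma inv_pos: "0 < x \<Longrightarrow> 0 < g x"
  using inv_less_iff[of 0 x] by (simp add: inv_zero)

section \<open>Regular variation transported along the inverse\<close>

lemma inv_at_top: "filterlim g at_top at_top"
  unfolding filterlim_at_top_ge[where c = 0]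
proof (intro allI impI)
  fix Z :: real
  assume Z: "0 \<le> Z"
  show "\<forall>\<^sub>F x in at_top. Z \<le> g x"
    using eventually_ge_at_top[of "max 0 (h Z)"]
  proof eventually_elim
    case (elim x)
    then show ?case
      using le_iff[of Z "g x"] Z by (simp add: right_inv inv_nonneg)
  qed
qed

text \<open>Substitute \<open>t = g x\<close> in the definition of regular variation:
  \<open>g x\<close> tends to infinity, and the denominator \<open>h t\<close> becomes
  \<open>x\<close>.\<close>

lemma regularly_varying_inv:
  assumes "regularly_varying h \<alpha>" and "0 < c"
  shows "((\<lambda>x. h (c * g x) / x) \<longlongrightarrow> c powr \<alpha>) at_top"
proof -
  have "((\<lambda>x. h (c * g x) / h (g x)) \<longlongrightarrow> c powr \<alpha>) at_top"
    using assms filterlim_compose[OF _ inv_at_top] unfolding regularly_varying_def by blast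
  moreover have "\<forall>\<^sub>F x in at_top. h (c * g x) / h (g x) = h (c * g x) / x"
    using eventually_ge_at_top[of 0] by eventually_elim (simp add: right_inv)
  ultimately show ?thesis
    by (rule Lim_transform_eventually)
qed

text \<open>Applying \<open>h\<close> turns a comparison of \<open>g (l * x)\<close> with
  \<open>c * g x\<close> into one of \<open>l * x\<close> with \<open>h (c * g x)\<close>, which is
  asymptotic to \<open>c powr \<alpha> * x\<close>. So the critical value of \<open>c\<close> solves
  \<open>c powr \<alpha> = l\<close>.\<close>

lemma inv_ratio_tendsto:
  assumes h: "regularly_varying h \<alpha>" and \<alpha>: "0 < \<alpha>" and l: "0 \<le> l"
  shows "((\<lambda>x. g (l * x) / g x) \<longlongrightarrow> l powr (1 / \<alpha>)) at_top"
proof (cases "l = 0")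
  case True
  then show ?thesis by (simp add: inv_zero)
next
  case False
  with l have l: "0 < l" by simp
  have l_powr: "(l powr (1 / \<alpha>)) powr \<alpha> = l"
    using l \<alpha> by (simp add: powr_powr)
  show ?thesis
  proof (rule order_tendstoI)
    fix a
    assume "a < l powr (1 / \<alpha>)"
    \<comment> \<open>The bound \<open>a\<close> may be negative; the maximum with \<open>0\<close>
      forces \<open>c\<close> to be positive, as regular variation requires.\<close>
    with l have "max a 0 < l powr (1 / \<alpha>)" by simp
    then obtain c where c: "max a 0 < c" "c < l powr (1 / \<alpha>)"
      using dense by blast
    have "c powr \<alpha> < l"
      using powr_less_mono2[OF \<alpha> _ c(2)] c(1) by (simp add: l_powr)
    then have "\<forall>\<^sub>F x in at_top. h (c * g x) / x < l"
      using regularly_varying_inv[OF h, of c] c(1) by (auto intro: order_tendstoD(2))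
    then show "\<forall>\<^sub>F x in at_top. a < g (l * x) / g x"
      using eventually_gt_at_top[of 0]
    proof eventually_elim
      case (elim x)
      then have "h (c * g x) < h (g (l * x))"
        using l by (simp add: right_inv divide_simps)
      then have "c * g x < g (l * x)"
        using less_iff[of "c * g x" "g (l * x)"] c(1) elim l by (simp add: inv_nonneg)
      then have "c < g (l * x) / g x"
        using inv_pos elim by (simp add: field_simps)
      with c show ?case by simp
    qed
  next
    fix a
    assume "l powr (1 / \<alpha>) < a"
    then obtain c where c: "l powr (1 / \<alpha>) < c" "c < a"
      using dense by blast
    have c0: "0 < c"
      using c(1) powr_ge_zero[of l "1 / \<alpha>"] by linarith
    have "l < c powr \<alpha>"
      using powr_less_mono2[OF \<alpha> _ c(1)] by (simp add: l_powr)
    then have "\<forall>\<^sub>F x in at_top. l < h (c * g x) / x"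
      using regularly_varying_inv[OF h c0] by (auto intro: order_tendstoD(1))
    then show "\<forall>\<^sub>F x in at_top. g (l * x) / g x < a"
      using eventually_gt_at_top[of 0]
    proof eventually_elim
      case (elim x)
      then have "h (g (l * x)) < h (c * g x)"
        using l by (simp add: right_inv divide_simps)
      then have "g (l * x) < c * g x"
        using less_iff[of "g (l * x)" "c * g x"] c0 elim l by (simp add: inv_nonneg)
      then have "g (l * x) / g x < c"
        using inv_pos elim by (simp add: field_simps)
      with c show ?case by simp
    qed
  qed
qed

text \<open>Eventually \<open>s x\<close> lies between \<open>c * g x\<close> for constants
  \<open>c\<close> just below and just above \<open>S\<close>. Monotonicity of \<open>h\<close>
  carries these bounds over, replacing any uniformity in \<open>c\<close>, and continuity of
  \<open>c powr \<alpha>\<close> at \<open>S\<close> closes the gap.\<close>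

lemma regularly_varying_compose:
  assumes h: "regularly_varying h \<alpha>" and S: "0 < S"
    and s: "((\<lambda>x. s x / g x) \<longlongrightarrow> S) at_top"
  shows "((\<lambda>x. h (s x) / x) \<longlongrightarrow> S powr \<alpha>) at_top"
proof (rule order_tendstoI)
  have cont: "((\<lambda>c. c powr \<alpha>) \<longlongrightarrow> S powr \<alpha>) (at S within A)" for A
    using S by (intro tendsto_intros) auto
  {
    fix a
    assume "a < S powr \<alpha>"
    then have "\<forall>\<^sub>F c in at_left S. a < c powr \<alpha>"
      by (rule order_tendstoD(1)[OF cont])
    \<comment> \<open>Since \<open>S\<close> is positive, its left neighbourhood can be cut down to
      positive multipliers.\<close>
    then have "\<forall>\<^sub>F c in at_left S. a < c powr \<alpha> \<and> 0 < c \<and> c < S"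
      using eventually_at_left_real[OF S] by eventually_elim auto
    then obtain c where c: "a < c powr \<alpha>" "0 < c" "c < S"
      using eventually_happens'[OF trivial_limit_at_left_real] by blast
    have "\<forall>\<^sub>F x in at_top. a < h (c * g x) / x"
      using regularly_varying_inv[OF h c(2)] c(1) by (auto intro: order_tendstoD(1))
    moreover have "\<forall>\<^sub>F x in at_top. c < s x / g x"
      using s c(3) by (auto intro: order_tendstoD(1))
    ultimately show "\<forall>\<^sub>F x in at_top. a < h (s x) / x"
      using eventually_gt_at_top[of 0]
    proof eventually_elim
      case (elim x)
      then have *: "c * g x < s x"
        using inv_pos by (simp add: field_simps)
      have "0 \<le> c * g x"
        using c(2) elim inv_nonneg by simp
      with * have "h (c * g x) \<le> h (s x)"
        using le_iff[of "c * g x" "s x"] by linarith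
      then have "h (c * g x) / x \<le> h (s x) / x"
        using elim by (simp add: divide_right_mono)
      with elim show ?case by simp
    qed
  }
  {
    fix a
    assume "S powr \<alpha> < a"
    then have "\<forall>\<^sub>F c in at_right S. c powr \<alpha> < a"
      by (rule order_tendstoD(2)[OF cont])
    then have "\<forall>\<^sub>F c in at_right S. c powr \<alpha> < a \<and> S < c"
      using eventually_at_right_less[of S] by eventually_elim auto
    then obtain c where c: "c powr \<alpha> < a" "S < c"
      using eventually_happens'[OF trivial_limit_at_right_real] by blast
    have c0: "0 < c"
      using S c(2) by simp
    have "\<forall>\<^sub>F x in at_top. h (c * g x) / x < a"
      using regularly_varying_inv[OF h c0] c(1) by (auto intro: order_tendstoD(2))
    \<comment> \<open>This keeps \<open>s x\<close> in the half-line, the only place where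
      \<open>h\<close> is known to be monotone.\<close>
    moreover have "\<forall>\<^sub>F x in at_top. 0 < s x / g x"
      using s S by (auto intro: order_tendstoD(1))
    moreover have "\<forall>\<^sub>F x in at_top. s x / g x < c"
      using s c(2) by (auto intro: order_tendstoD(2))
    ultimately show "\<forall>\<^sub>F x in at_top. h (s x) / x < a"
      using eventually_gt_at_top[of 0]
    proof eventually_elim
      case (elim x)
      then have "0 < g x"
        using inv_pos by simp
      with elim have "0 < s x" "s x < c * g x"
        by (simp_all add: field_simps)
      then have "h (s x) \<le> h (c * g x)"
        using le_iff[of "s x" "c * g x"] by linarith
      then have "h (s x) / x \<le> h (c * g x) / x"
        using elim by (simp add: divide_right_mono)
      with elim show ?case by simp
    qed
  }
qed

lemma regularly_varying_sum:
  assumes h: "regularly_varying h \<alpha>" and \<alpha>: "0 < \<alpha>"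
    and I: "finite I" and l: "\<And>i. i \<in> I \<Longrightarrow> 0 \<le> l i" and j: "j \<in> I" "0 < l j"
  shows "((\<lambda>x. h (\<Sum>i\<in>I. g (l i * x)) / x) \<longlongrightarrow> (\<Sum>i\<in>I. l i powr (1 / \<alpha>)) powr \<alpha>) at_top"
proof (rule regularly_varying_compose[OF h])
  show "0 < (\<Sum>i\<in>I. l i powr (1 / \<alpha>))"
    using I j by (intro sum_pos2[of I j]) auto
  show "((\<lambda>x. (\<Sum>i\<in>I. g (l i * x)) / g x) \<longlongrightarrow> (\<Sum>i\<in>I. l i powr (1 / \<alpha>))) at_top"
    unfolding sum_divide_distrib
    using inv_ratio_tendsto[OF h \<alpha>] l by (intro tendsto_sum) auto
qed

text \<open>Here \<open>g (l * x) / g x\<close> is unbounded for \<open>l > 1\<close>, so the sum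
  cannot be compared with \<open>g x\<close>; it is compared with its largest term
  \<open>g (l j * x)\<close> instead.\<close>

lemma slowly_varying_sum:
  assumes h: "slowly_varying h"
    and I: "finite I" and l: "\<And>i. i \<in> I \<Longrightarrow> 0 \<le> l i \<and> l i \<le> l j" and j: "j \<in> I" "0 < l j"
  shows "((\<lambda>x. h (\<Sum>i\<in>I. g (l i * x)) / x) \<longlongrightarrow> l j) at_top"
proof -
  define n where "n = real (card I)"
  have n: "0 < n"
    using I j by (auto simp: n_def card_gt_0_iff)
  \<comment> \<open>The limit for the multiplier \<open>n\<close> is taken along
    \<open>l j * x\<close> in place of \<open>x\<close>; the factor \<open>l j\<close> is restored
    afterwards.\<close>
  have "filterlim (\<lambda>x. l j * x) at_top at_top"
    using j(2) by (rule filterlim_tendsto_pos_mult_at_top[OF tendsto_const _ filterlim_ident])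
  moreover have "((\<lambda>x. h (n * g x) / x) \<longlongrightarrow> 1) at_top"
    using regularly_varying_inv[of 0 n] h n by (simp add: slowly_varying_def)
  ultimately have "((\<lambda>x. h (n * g (l j * x)) / (l j * x)) \<longlongrightarrow> 1) at_top"
    by (rule filterlim_compose[rotated])
  from tendsto_mult_right[OF this, of "l j"]
  have upper: "((\<lambda>x. h (n * g (l j * x)) / x) \<longlongrightarrow> l j) at_top"
    using j(2) by simp
  \<comment> \<open>The lower bound is constant because the single term \<open>j\<close> already
    gives \<open>h (g (l j * x)) = l j * x\<close>.\<close>
  have bounds: "l j \<le> h (\<Sum>i\<in>I. g (l i * x)) / x"
    "h (\<Sum>i\<in>I. g (l i * x)) / x \<le> h (n * g (l j * x)) / x" if x: "0 < x" for x
  proof -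
    have nonneg: "0 \<le> g (l i * x)" if "i \<in> I" for i
      using l[OF that] x by (simp add: inv_nonneg)
    have "g (l i * x) \<le> g (l j * x)" if "i \<in> I" for i
      using l[OF that] j x by (simp add: inv_le_iff)
    then have "(\<Sum>i\<in>I. g (l i * x)) \<le> n * g (l j * x)"
      unfolding n_def by (rule sum_bounded_above)
    moreover have "0 \<le> (\<Sum>i\<in>I. g (l i * x))"
      using nonneg by (rule sum_nonneg)
    ultimately have "h (\<Sum>i\<in>I. g (l i * x)) \<le> h (n * g (l j * x))"
      using le_iff by simp
    then show "h (\<Sum>i\<in>I. g (l i * x)) / x \<le> h (n * g (l j * x)) / x"
      using x by (simp add: divide_right_mono)
    have "g (l j * x) \<le> (\<Sum>i\<in>I. g (l i * x))"
      using I j nonneg by (intro member_le_sum) auto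
    then have "h (g (l j * x)) \<le> h (\<Sum>i\<in>I. g (l i * x))"
      using le_iff[OF nonneg[OF j(1)]] nonneg[OF j(1)] by simp
    then show "l j \<le> h (\<Sum>i\<in>I. g (l i * x)) / x"
      using x j by (simp add: right_inv field_simps)
  qed
  show ?thesis
    by (rule tendsto_sandwich[OF _ _ tendsto_const upper];
        rule eventually_mono[OF eventually_gt_at_top[of 0]]) (auto intro: bounds)
qed

end

section \<open>Archimedean generators and their inverses\<close>

lemma
  assumes \<phi>: "archimedean_generator \<phi>"
  shows generator_inv_mem: "generator_inv \<phi> y \<in> {0..1}"
    and generator_generator_inv: "\<phi> (generator_inv \<phi> y) = y"
    and generator_inv_generator: "u \<in> {0..1} \<Longrightarrow> generator_inv \<phi> (\<phi> u) = u"
    and generator_antimono: "u \<in> {0..1} \<Longrightarrow> v \<in> {0..1} \<Longrightarrow> u < v \<Longrightarrow> \<phi> v < \<phi> u"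
proof -
  have cont: "continuous_on {0..1} \<phi>" and ends: "\<phi> 0 = \<infinity>" "\<phi> 1 = 0"
    and anti: "strict_antimono_on {0..1} \<phi>"
    using \<phi> by (auto simp: archimedean_generator_def)
  show less: "u \<in> {0..1} \<Longrightarrow> v \<in> {0..1} \<Longrightarrow> u < v \<Longrightarrow> \<phi> v < \<phi> u" for u v
    using anti by (auto simp: monotone_on_def)
  have "inj_on \<phi> {0..1}"
    by (rule linorder_inj_onI) (use less in force)+
  then show "u \<in> {0..1} \<Longrightarrow> generator_inv \<phi> (\<phi> u) = u" for u
    by (simp add: generator_inv_def)
  \<comment> \<open>By the intermediate value theorem with end values \<infinity> and 0,
    \<open>\<phi>\<close> is onto all of \<open>ennreal\<close>, so \<open>y\<close> needs no side
    condition.\<close>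
  have y: "y \<in> \<phi> ` {0..1}" for y
    using IVT2'[of \<phi> 1 y 0] cont ends by auto
  show "generator_inv \<phi> y \<in> {0..1}" "\<phi> (generator_inv \<phi> y) = y"
    unfolding generator_inv_def by (rule inv_into_into[OF y], rule f_inv_into_f[OF y])
qed

lemma generator_finite:
  assumes \<phi>: "archimedean_generator \<phi>" and "0 < u" "u \<le> 1"
  shows "\<phi> u < \<infinity>"
  using generator_antimono[OF \<phi>, of 0 u] assms by (auto simp: archimedean_generator_def)

text \<open>The inverse vanishes only at \<infinity> because \<open>\<phi> 0 = \<infinity>\<close>,
  and \<open>ennreal t\<close> is always finite. Logarithms of the inverse are therefore taken at
  positive numbers.\<close>

lemma generator_inv_pos:
  assumes \<phi>: "archimedean_generator \<phi>"
  shows "0 < generator_inv \<phi> (ennreal t)"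
proof -
  have "generator_inv \<phi> (ennreal t) \<noteq> 0"
    using generator_generator_inv[OF \<phi>, of "ennreal t"] \<phi>
    by (auto simp: archimedean_generator_def)
  then show ?thesis
    using generator_inv_mem[OF \<phi>, of "ennreal t"] by auto
qed

lemma half_line_bijection_generator:
  assumes \<phi>: "archimedean_generator \<phi>"
  shows "half_line_bijection (\<lambda>t. - ln (generator_inv \<phi> (ennreal t)))
           (\<lambda>x. enn2real (\<phi> (exp (- x))))"
proof
  show "strict_mono_on {0..} (\<lambda>t. - ln (generator_inv \<phi> (ennreal t)))"
  proof (rule strict_mono_onI)
    fix s t :: real
    assume "s \<in> {0..}" "t \<in> {0..}" "s < t"
    then have "ennreal s < ennreal t"
      by (simp add: ennreal_less_iff)
    \<comment> \<open>By trichotomy: applying \<open>\<phi>\<close> to either alternative would give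
      \<open>ennreal t \<le> ennreal s\<close>.\<close>
    then have "generator_inv \<phi> (ennreal t) < generator_inv \<phi> (ennreal s)"
      using generator_antimono[OF \<phi> generator_inv_mem[OF \<phi>] generator_inv_mem[OF \<phi>],
          of "ennreal s" "ennreal t"]
      by (metis generator_generator_inv[OF \<phi>] not_less_iff_gr_or_eq)
    then show "- ln (generator_inv \<phi> (ennreal s)) < - ln (generator_inv \<phi> (ennreal t))"
      by (simp add: generator_inv_pos[OF \<phi>])
  qed
  show "- ln (generator_inv \<phi> (ennreal 0)) = 0"
    using generator_inv_generator[OF \<phi>, of 1] \<phi> by (simp add: archimedean_generator_def)
next
  fix x :: real
  assume "0 \<le> x"
  \<comment> \<open>As \<open>exp (- x)\<close> lies in \<open>(0, 1]\<close>, its image under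
    \<open>\<phi>\<close> is finite and \<open>enn2real\<close> loses nothing.\<close>
  then show "- ln (generator_inv \<phi> (ennreal (enn2real (\<phi> (exp (- x)))))) = x"
    using generator_finite[OF \<phi>, of "exp (- x)"] generator_inv_generator[OF \<phi>, of "exp (- x)"]
    by simp
qed simp

section \<open>The tail ratio as a limit at infinity\<close>

lemma Max_range_vec:
  fixes l :: "real ^ 'n"
  assumes "\<forall>i. 0 \<le> l $ i" and "l \<noteq> 0"
  obtains j where "l $ j = (MAX i. l $ i)" and "0 < l $ j" and "\<And>i. l $ i \<le> l $ j"
proof -
  have "(MAX i. l $ i) \<in> range (($) l)"
    by (rule Max_in) auto
  then obtain j where j: "l $ j = (MAX i. l $ i)"
    by (metis imageE)
  then have le: "l $ i \<le> l $ j" for i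
    by simp
  obtain k where "l $ k \<noteq> 0"
    using assms(2) by (auto simp: vec_eq_iff)
  with assms(1) le[of k] have "0 < l $ j"
    by (metis less_le_trans order_le_less)
  from j this le show thesis
    by (rule that)
qed

text \<open>The signs of numerator and denominator cancel. Dividing \<open>h\<close> by
  \<open>- ln u\<close> gives the quotient whose limit the locale provides, with
  \<open>x = - ln u\<close>.\<close>

lemma tail_ratio_archimedean_copula:
  fixes l :: "real ^ 'n"
  assumes \<phi>: "archimedean_generator \<phi>" and l: "\<forall>i. 0 \<le> l $ i" "l \<noteq> 0"
    and u: "0 < u" "u < 1"
  defines "h \<equiv> \<lambda>t. - ln (generator_inv \<phi> (ennreal t))"
    and "g \<equiv> \<lambda>x. enn2real (\<phi> (exp (- x)))"
  shows "tail_ratio (archimedean_copula \<phi>) l u =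
    (MAX i. l $ i) / (h (\<Sum>i\<in>UNIV. g (l $ i * - ln u)) / - ln u)"
proof -
  obtain j where j: "l $ j = (MAX i. l $ i)" "\<And>i. l $ i \<le> l $ j"
    using Max_range_vec[OF l] by metis
  have ln_u: "ln u < 0"
    using u by simp
  \<comment> \<open>Multiplication by the negative number \<open>ln u\<close> exchanges minimum and
    maximum.\<close>
  have "(MIN i. ln (u powr (l $ i))) = l $ j * ln u"
    using u j(2) ln_u by (intro Min_eqI) (auto simp: ln_powr intro: mult_right_mono_neg)
  moreover have "\<phi> (u powr (l $ i)) = ennreal (g (l $ i * - ln u))" for i
  proof -
    \<comment> \<open>Arguments in \<open>(0, 1]\<close> have finite generator values, so the sum in
      \<open>ennreal\<close> is the image of a real sum.\<close>
    have "u powr (l $ i) \<le> 1"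
      using u l(1) by (intro powr_le1) auto
    then have "\<phi> (u powr (l $ i)) < \<infinity>"
      using generator_finite[OF \<phi>] u by simp
    then show ?thesis
      using u by (simp add: g_def powr_def)
  qed
  then have "archimedean_copula \<phi> (\<chi> i. u powr (l $ i)) =
      generator_inv \<phi> (ennreal (\<Sum>i\<in>UNIV. g (l $ i * - ln u)))"
    by (simp add: archimedean_copula_def sum_ennreal g_def del: mult_minus_right)
  then have "ln (archimedean_copula \<phi> (\<chi> i. u powr (l $ i))) =
      - h (\<Sum>i\<in>UNIV. g (l $ i * - ln u))"
    by (simp add: h_def)
  ultimately show ?thesis
    unfolding tail_ratio_def by (simp add: j)
qed

lemma weak_lower_tail_dep_archimedean:
  fixes l :: "real ^ 'n"
  assumes \<phi>: "archimedean_generator \<phi>" and l: "\<forall>i. 0 \<le> l $ i" "l \<noteq> 0"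
  defines "h \<equiv> \<lambda>t. - ln (generator_inv \<phi> (ennreal t))"
    and "g \<equiv> \<lambda>x. enn2real (\<phi> (exp (- x)))"
  assumes lim: "((\<lambda>x. h (\<Sum>i\<in>UNIV. g (l $ i * x)) / x) \<longlongrightarrow> L) at_top" and "L \<noteq> 0"
  shows "weak_lower_tail_dep_exists (archimedean_copula \<phi>) l"
    and "weak_lower_tail_dep (archimedean_copula \<phi>) l = (MAX i. l $ i) / L"
proof -
  have "filterlim (\<lambda>u :: real. - ln u) at_top (at_right 0)"
    using ln_at_0 by (simp add: filterlim_uminus_at_top)
  from filterlim_compose[OF lim this]
  have "((\<lambda>u. (MAX i. l $ i) / (h (\<Sum>i\<in>UNIV. g (l $ i * - ln u)) / - ln u)) \<longlongrightarrow>
      (MAX i. l $ i) / L) (at_right 0)"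
    using \<open>L \<noteq> 0\<close> by (intro tendsto_divide tendsto_const) auto
  moreover have "\<forall>\<^sub>F u in at_right 0.
      (MAX i. l $ i) / (h (\<Sum>i\<in>UNIV. g (l $ i * - ln u)) / - ln u) =
      tail_ratio (archimedean_copula \<phi>) l u"
    \<comment> \<open>The formula holds for \<open>0 < u < 1\<close>, a right neighbourhood of
      0.\<close>
    using eventually_at_right_real[of 0 1] unfolding h_def g_def
    by (auto elim!: eventually_mono simp: tail_ratio_archimedean_copula[OF \<phi> l])
  ultimately have *: "(tail_ratio (archimedean_copula \<phi>) l \<longlongrightarrow> (MAX i. l $ i) / L) (at_right 0)"
    by (rule Lim_transform_eventually)
  then show "weak_lower_tail_dep_exists (archimedean_copula \<phi>) l"
    by (auto simp: weak_lower_tail_dep_exists_def)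
  from * show "weak_lower_tail_dep (archimedean_copula \<phi>) l = (MAX i. l $ i) / L"
    unfolding weak_lower_tail_dep_def by (intro tendsto_Lim) auto
qed

theorem proposition4:
  fixes \<phi> :: "real \<Rightarrow> ennreal" and C :: "real ^ 'n \<Rightarrow> real"
  assumes "archimedean_generator \<phi>"
    and "C = archimedean_copula \<phi>"
  shows "(\<forall>\<alpha>>0. regularly_varying (\<lambda>t. ln (generator_inv \<phi> (ennreal t))) \<alpha> \<longrightarrow>
            (\<forall>l. (\<forall>i. 0 \<le> l $ i) \<and> l \<noteq> 0 \<longrightarrow>
               weak_lower_tail_dep_exists C l \<and>
               weak_lower_tail_dep C l =
                 (MAX i. l $ i) / (\<Sum>i\<in>UNIV. (l $ i) powr (1 / \<alpha>)) powr \<alpha>)) \<and>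
         (slowly_varying (\<lambda>t. ln (generator_inv \<phi> (ennreal t))) \<longrightarrow>
            (\<forall>l. (\<forall>i. 0 \<le> l $ i) \<and> l \<noteq> 0 \<longrightarrow>
               weak_lower_tail_dep_exists C l \<and> weak_lower_tail_dep C l = 1))"
proof (intro conjI allI impI; elim conjE)
  interpret half_line_bijection "\<lambda>t. - ln (generator_inv \<phi> (ennreal t))"
    "\<lambda>x. enn2real (\<phi> (exp (- x)))"
    using assms(1) by (rule half_line_bijection_generator)
  fix l :: "real ^ 'n"
  assume l: "\<forall>i. 0 \<le> l $ i" "l \<noteq> 0"
  obtain j where j: "l $ j = (MAX i. l $ i)" "0 < l $ j" "\<And>i. l $ i \<le> l $ j"
    using Max_range_vec[OF l] by metis
  note dep = weak_lower_tail_dep_archimedean[OF assms(1) l]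
  {
    fix \<alpha> :: real
    assume \<alpha>: "0 < \<alpha>"
      and "regularly_varying (\<lambda>t. ln (generator_inv \<phi> (ennreal t))) \<alpha>"
    \<comment> \<open>The ratio defining regular variation is unchanged when the function changes
      sign.\<close>
    then have rv: "regularly_varying (\<lambda>t. - ln (generator_inv \<phi> (ennreal t))) \<alpha>"
      by (simp add: regularly_varying_def)
    have "0 < (\<Sum>i\<in>UNIV. (l $ i) powr (1 / \<alpha>))"
      using j(2) by (intro sum_pos2[of UNIV j]) auto
    then have "(\<Sum>i\<in>UNIV. (l $ i) powr (1 / \<alpha>)) powr \<alpha> \<noteq> 0"
      by simp
    note dep = dep[OF regularly_varying_sum[OF rv \<alpha> finite, of UNIV "($) l" j] this]
    show "weak_lower_tail_dep_exists C l"
      "weak_lower_tail_dep C l = (MAX i. l $ i) / (\<Sum>i\<in>UNIV. (l $ i) powr (1 / \<alpha>)) powr \<alpha>"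
      unfolding assms(2) by (rule dep; use l j in auto)+
  }
  {
    assume "slowly_varying (\<lambda>t. ln (generator_inv \<phi> (ennreal t)))"
    then have "slowly_varying (\<lambda>t. - ln (generator_inv \<phi> (ennreal t)))"
      by (simp add: slowly_varying_def regularly_varying_def)
    from slowly_varying_sum[OF this, of UNIV "($) l" j]
    have "((\<lambda>x. - ln (generator_inv \<phi> (ennreal (\<Sum>i\<in>UNIV. enn2real (\<phi> (exp (- (l $ i * x))))))) / x)
        \<longlongrightarrow> l $ j) at_top"
      using l j by simp
    \<comment> \<open>The limit \<open>L\<close> is now the maximal weight \<open>l $ j\<close>
      itself, so the quotient is 1.\<close>
    from dep[OF this] j
    show "weak_lower_tail_dep_exists C l" "weak_lower_tail_dep C l = 1"
      unfolding assms(2) by auto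
  }
qed

end
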